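(* Every Sahlqvist formula is locally transferrable.
   Context: Formulas are built from variables and constants $\mathbf{0},\mathbf{1}$ using ${\sim},\wedge,\vee,\rightarrow,\Box,\lozenge$. A formula is positive iff it is built from variables only using $\wedge,\vee,\Box,\lozenge$. A Sahlqvist implication is a formula $\phi\rightarrow\chi$ where $\chi$ is positive and $\phi$ is generated by $\phi::=l\mid\phi\wedge\phi\mid\phi\vee\phi\mid\lozenge\phi$ with $l$ ranging over variables $p$, negated variables ${\sim}p$, and boxed variables $\Box^k p$ ($k\in\mathbb{N}$, $k$ boxes). Sahlqvist formulas are generated by $\psi::=\tau\mid\psi\wedge\psi\mid\psi\vee\psi'\mid\Box\psi$ with $\tau$ a Sahlqvist implication and, in a disjunction $\psi\vee\psi'$, $\psi$ and $\psi'$ sharing no variables. On a crisp frame $\langle W,R\rangle$ ($W\ne\varnothing$, $R\subseteq W\times W$), a $\mathbf{K}\mathsf{biG}$ valuation $v:\mathtt{Prop}\times W\to[0,1]$ is extended by: $\mathbf{0}\mapsto0$, $\mathbf{1}\mapsto1$, $\wedge,\vee$ as $\min,\max$, $a\rightarrow b=1$ if $a\le b$ else $b$, ${\sim}a=1$ iff $a=0$ (else $0$), $v(\Box\phi,w)=\inf\{v(\phi,w'):wRw'\}$, $v(\lozenge\phi,w)=\sup\{v(\phi,w'):wRw'\}$ ($\inf\varnothing=1,\sup\varnothing=0$). $\mathfrak{F},w\models_{\mathbf{K}\mathsf{biG}}\phi$ means $v(\phi,w)=1$ for every such valuation on $\mathfrak{F}$; $\mathfrak{F},w\models_{\mathbf{K}}\phi$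 means $\phi$ is true at $w$ under every classical valuation on $\mathfrak{F}$ in classical modal logic $\mathbf{K}$. $\phi$ is locally transferrable iff for every crisp frame $\mathfrak{F}$ and every $w$ in it, $\mathfrak{F},w\models_{\mathbf{K}}\phi$ iff $\mathfrak{F},w\models_{\mathbf{K}\mathsf{biG}}\phi$. *)

theory Defs
  imports Complex_Main
begin

datatype (vars: 'p) fm =
    Var 'p
  | Zero
  | One
  | Neg "'p fm"
  | And "'p fm" "'p fm"
  | Or "'p fm" "'p fm"
  | Imp "'p fm" "'p fm"
  | Box "'p fm"
  | Dia "'p fm"

inductive positive :: "'p fm \<Rightarrow> bool" where
  "positive (Var p)"
| "positive \<phi> \<Longrightarrow> positive \<chi> \<Longrightarrow> positive (And \<phi> \<chi>)"
| "positive \<phi> \<Longrightarrow> positive \<chi> \<Longrightarrow> positive (Or \<phi> \<chi>)"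
| "positive \<phi> \<Longrightarrow> positive (Box \<phi>)"
| "positive \<phi> \<Longrightarrow> positive (Dia \<phi>)"

inductive sahlqvist_antecedent :: "'p fm \<Rightarrow> bool" where
  "sahlqvist_antecedent (Var p)"
| "sahlqvist_antecedent (Neg (Var p))"
| "sahlqvist_antecedent ((Box ^^ k) (Var p))"
| "sahlqvist_antecedent \<phi> \<Longrightarrow> sahlqvist_antecedent \<chi> \<Longrightarrow> sahlqvist_antecedent (And \<phi> \<chi>)"
| "sahlqvist_antecedent \<phi> \<Longrightarrow> sahlqvist_antecedent \<chi> \<Longrightarrow> sahlqvist_antecedent (Or \<phi> \<chi>)"
| "sahlqvist_antecedent \<phi> \<Longrightarrow> sahlqvist_antecedent (Dia \<phi>)"

definition sahlqvist_implication :: "'p fm \<Rightarrow> bool" where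
  "sahlqvist_implication \<tau> \<longleftrightarrow>
     (\<exists>\<phi> \<chi>. \<tau> = Imp \<phi> \<chi> \<and> sahlqvist_antecedent \<phi> \<and> positive \<chi>)"

inductive sahlqvist :: "'p fm \<Rightarrow> bool" where
  "sahlqvist_implication \<tau> \<Longrightarrow> sahlqvist \<tau>"
| "sahlqvist \<phi> \<Longrightarrow> sahlqvist \<psi> \<Longrightarrow> sahlqvist (And \<phi> \<psi>)"
| "sahlqvist \<phi> \<Longrightarrow> sahlqvist \<psi> \<Longrightarrow> vars \<phi> \<inter> vars \<psi> = {} \<Longrightarrow> sahlqvist (Or \<phi> \<psi>)"
| "sahlqvist \<phi> \<Longrightarrow> sahlqvist (Box \<phi>)"

definition crisp_frame :: "'w set \<Rightarrow> 'w rel \<Rightarrow> bool" where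
  "crisp_frame W R \<longleftrightarrow> W \<noteq> {} \<and> R \<subseteq> W \<times> W"

primrec K_true :: "'w rel \<Rightarrow> ('p \<Rightarrow> 'w \<Rightarrow> bool) \<Rightarrow> 'p fm \<Rightarrow> 'w \<Rightarrow> bool" where
  "K_true R v (Var p) w \<longleftrightarrow> v p w"
| "K_true R v Zero w \<longleftrightarrow> False"
| "K_true R v One w \<longleftrightarrow> True"
| "K_true R v (Neg \<phi>) w \<longleftrightarrow> \<not> K_true R v \<phi> w"
| "K_true R v (And \<phi> \<psi>) w \<longleftrightarrow> K_true R v \<phi> w \<and> K_true R v \<psi> w"
| "K_true R v (Or \<phi> \<psi>) w \<longleftrightarrow> K_true R v \<phi> w \<or> K_true R v \<psi> w"
| "K_true R v (Imp \<phi> \<psi>) w \<longleftrightarrow> (K_true R v \<phi> w \<longrightarrow> K_true R v \<psi> w)"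
| "K_true R v (Box \<phi>) w \<longleftrightarrow> (\<forall>w'. (w, w') \<in> R \<longrightarrow> K_true R v \<phi> w')"
| "K_true R v (Dia \<phi>) w \<longleftrightarrow> (\<exists>w'. (w, w') \<in> R \<and> K_true R v \<phi> w')"

definition K_valid_at :: "'w rel \<Rightarrow> 'w \<Rightarrow> 'p fm \<Rightarrow> bool" where
  "K_valid_at R w \<phi> \<longleftrightarrow> (\<forall>v. K_true R v \<phi> w)"

(* Infima and suprema are those of the lattice [0,1]: on the empty set they are 1 and 0,
   whereas Inf {} and Sup {} on the reals are unspecified. *)
primrec KbiG_val :: "'w rel \<Rightarrow> ('p \<Rightarrow> 'w \<Rightarrow> real) \<Rightarrow> 'p fm \<Rightarrow> 'w \<Rightarrow> real" where
  "KbiG_val R v (Var p) w = v p w"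
| "KbiG_val R v Zero w = 0"
| "KbiG_val R v One w = 1"
| "KbiG_val R v (Neg \<phi>) w = (if KbiG_val R v \<phi> w = 0 then 1 else 0)"
| "KbiG_val R v (And \<phi> \<psi>) w = min (KbiG_val R v \<phi> w) (KbiG_val R v \<psi> w)"
| "KbiG_val R v (Or \<phi> \<psi>) w = max (KbiG_val R v \<phi> w) (KbiG_val R v \<psi> w)"
| "KbiG_val R v (Imp \<phi> \<psi>) w =
     (if KbiG_val R v \<phi> w \<le> KbiG_val R v \<psi> w then 1 else KbiG_val R v \<psi> w)"
| "KbiG_val R v (Box \<phi>) w =
     (if R `` {w} = {} then 1 else (INF w'\<in>R `` {w}. KbiG_val R v \<phi> w'))"
| "KbiG_val R v (Dia \<phi>) w =
     (if R `` {w} = {} then 0 else (SUP w'\<in>R `` {w}. KbiG_val R v \<phi> w'))"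

definition KbiG_valuation :: "'w set \<Rightarrow> ('p \<Rightarrow> 'w \<Rightarrow> real) \<Rightarrow> bool" where
  "KbiG_valuation W v \<longleftrightarrow> (\<forall>p. \<forall>w\<in>W. v p w \<in> {0..1})"

definition KbiG_valid_at :: "'w set \<Rightarrow> 'w rel \<Rightarrow> 'w \<Rightarrow> 'p fm \<Rightarrow> bool" where
  "KbiG_valid_at W R w \<phi> \<longleftrightarrow> (\<forall>v. KbiG_valuation W v \<longrightarrow> KbiG_val R v \<phi> w = 1)"

(* HOL cannot quantify over types inside a formula, so the type of worlds is a parameter. It is
   arbitrary in any theorem about TYPE('w), which therefore covers all crisp frames. Valuations
   are total on 'w; since R \<subseteq> W \<times> W, only their values on W matter at a world of W. *)
definition locally_transferrable :: "'w itself \<Rightarrow> 'p fm \<Rightarrow> bool" where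
  "locally_transferrable _ \<phi> \<longleftrightarrow>
     (\<forall>(W :: 'w set) R. crisp_frame W R \<longrightarrow>
        (\<forall>w\<in>W. K_valid_at R w \<phi> \<longleftrightarrow> KbiG_valid_at W R w \<phi>))"

end

theory Submission
  imports Defs
begin

text \<open>
  For the nontrivial direction, cut a \<open>[0,1]\<close>-valuation \<open>v\<close> at a level \<open>c\<close>, making \<open>p\<close> classically
  true where \<open>v p > c\<close>. If a Sahlqvist antecedent has value \<open>> c\<close> then it is true under the cut;
  if a positive formula is true under the cut then its value is \<open>\<ge> c\<close>. So classical validity of
  \<open>\<phi> \<rightarrow> \<chi>\<close> puts the value of \<open>\<chi>\<close> above every \<open>c\<close> below the value of \<open>\<phi>\<close>. For a disjunction
  without shared variables, classical valuations refuting the two disjuncts can be merged, so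
  one of the disjuncts is already valid.
\<close>

lemma INF_of_bool:
  assumes "A \<noteq> {}"
  shows "(INF x\<in>A. of_bool (P x) :: real) = of_bool (\<forall>x\<in>A. P x)"
proof (cases "\<forall>x\<in>A. P x")
  case True
  then have "(\<lambda>x. of_bool (P x) :: real) ` A = {1}"
    using assms by auto
  with True show ?thesis by simp
next
  case False
  then have "(INF x\<in>A. of_bool (P x) :: real) = 0"
    by (intro cInf_eq_minimum) auto
  with False show ?thesis by simp
qed

lemma SUP_of_bool:
  assumes "A \<noteq> {}"
  shows "(SUP x\<in>A. of_bool (P x) :: real) = of_bool (\<exists>x\<in>A. P x)"
proof (cases "\<exists>x\<in>A. P x")
  case True
  then have "(SUP x\<in>A. of_bool (P x) :: real) = 1"
    by (intro cSup_eq_maximum) auto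
  with True show ?thesis by simp
next
  case False
  then have "(\<lambda>x. of_bool (P x) :: real) ` A = {0}"
    using assms by auto
  with False show ?thesis by simp
qed

text \<open>On the values 0 and 1 every connective acts as its Boolean counterpart, an infimum
  becoming "for all" and a supremum "exists". Classical models are thus the two-valued ones.\<close>

lemma KbiG_val_of_bool:
  "KbiG_val R (\<lambda>p u. of_bool (v p u)) \<phi> w = of_bool (K_true R v \<phi> w)"
  by (induction \<phi> arbitrary: w) (auto simp: INF_of_bool SUP_of_bool)

lemma KbiG_valid_imp_K_valid:
  fixes \<phi> :: "'p fm" and R :: "'w rel"
  assumes "KbiG_valid_at W R w \<phi>"
  shows "K_valid_at R w \<phi>"
  unfolding K_valid_at_def
proof
  fix v :: "'p \<Rightarrow> 'w \<Rightarrow> bool"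
  have "KbiG_valuation W (\<lambda>p u. of_bool (v p u))"
    by (simp add: KbiG_valuation_def)
  then have "KbiG_val R (\<lambda>p u. of_bool (v p u)) \<phi> w = 1"
    using assms by (simp add: KbiG_valid_at_def)
  then show "K_true R v \<phi> w"
    by (simp add: KbiG_val_of_bool)
qed

lemma K_true_cong:
  assumes "\<And>p u. p \<in> vars \<phi> \<Longrightarrow> v p u = v' p u"
  shows "K_true R v \<phi> w = K_true R v' \<phi> w"
  using assms by (induction \<phi> arbitrary: w) auto

lemma K_valid_Or_disjoint:
  assumes "K_valid_at R w (Or \<phi> \<psi>)" and "vars \<phi> \<inter> vars \<psi> = {}"
  shows "K_valid_at R w \<phi> \<or> K_valid_at R w \<psi>"
proof (rule ccontr)
  assume "\<not> ?thesis"
  then obtain v1 v2 where v: "\<not> K_true R v1 \<phi> w" "\<not> K_true R v2 \<psi> w"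
    by (auto simp: K_valid_at_def)
  \<comment> \<open>Disjointness makes \<open>v\<close> agree with \<open>v2\<close> on
    \<open>vars \<psi>\<close>, so both refutations survive at \<open>w\<close>.\<close>
  define v where "v p = (if p \<in> vars \<phi> then v1 p else v2 p)" for p
  have "K_true R v \<phi> w = K_true R v1 \<phi> w"
    by (rule K_true_cong) (simp add: v_def)
  moreover have "K_true R v \<psi> w = K_true R v2 \<psi> w"
    using assms(2) by (intro K_true_cong) (auto simp: v_def)
  ultimately show False
    using v assms(1) by (auto simp: K_valid_at_def)
qed

text \<open>Real infima and suprema obey the lattice laws only for bounded sets; this supplies the
  bounds at worlds of \<open>W\<close>.\<close>

lemma KbiG_val_bounds:
  assumes "R \<subseteq> W \<times> W" and "KbiG_valuation W v" and "w \<in> W"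
  shows "KbiG_val R v \<phi> w \<in> {0..1}"
  using assms(3)
proof (induction \<phi> arbitrary: w)
  case (Var p)
  then show ?case using assms(2) by (simp add: KbiG_valuation_def)
next
  case (Box \<phi>)
  have succ: "KbiG_val R v \<phi> u \<in> {0..1}" if "u \<in> R `` {w}" for u
    using that Box.IH assms(1) by blast
  show ?case
  proof (cases "R `` {w} = {}")
    case False
    then obtain u where u: "u \<in> R `` {w}" by blast
    have "bdd_below (KbiG_val R v \<phi> ` R `` {w})"
      using succ by (intro bdd_belowI[of _ 0]) auto
    then have "(INF u\<in>R `` {w}. KbiG_val R v \<phi> u) \<le> KbiG_val R v \<phi> u"
      using u by (rule cINF_lower)
    moreover have "0 \<le> (INF u\<in>R `` {w}. KbiG_val R v \<phi> u)"
      using False succ by (intro cINF_greatest) auto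
    ultimately show ?thesis using False succ[OF u] by auto
  qed auto
next
  case (Dia \<phi>)
  have succ: "KbiG_val R v \<phi> u \<in> {0..1}" if "u \<in> R `` {w}" for u
    using that Dia.IH assms(1) by blast
  show ?case
  proof (cases "R `` {w} = {}")
    case False
    then obtain u where u: "u \<in> R `` {w}" by blast
    have "bdd_above (KbiG_val R v \<phi> ` R `` {w})"
      using succ by (intro bdd_aboveI[of _ 1]) auto
    then have "KbiG_val R v \<phi> u \<le> (SUP u\<in>R `` {w}. KbiG_val R v \<phi> u)"
      using u by (intro cSUP_upper)
    moreover have "(SUP u\<in>R `` {w}. KbiG_val R v \<phi> u) \<le> 1"
      using False succ by (intro cSUP_least) auto
    ultimately show ?thesis using False succ[OF u] by auto
  qed auto
next
  case (And \<phi> \<psi>)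
  then have "KbiG_val R v \<phi> w \<in> {0..1}" "KbiG_val R v \<psi> w \<in> {0..1}" by blast+
  then show ?case by (simp add: min_def)
next
  case (Or \<phi> \<psi>)
  then have "KbiG_val R v \<phi> w \<in> {0..1}" "KbiG_val R v \<psi> w \<in> {0..1}" by blast+
  then show ?case by (simp add: max_def)
next
  case (Imp \<phi> \<psi>)
  then have "KbiG_val R v \<psi> w \<in> {0..1}" by blast
  then show ?case by simp
qed simp_all

lemma KbiG_val_Box_le:
  assumes "R \<subseteq> W \<times> W" and "KbiG_valuation W v" and "(w, u) \<in> R"
  shows "KbiG_val R v (Box \<phi>) w \<le> KbiG_val R v \<phi> u"
proof -
  have "bdd_below (KbiG_val R v \<phi> ` R `` {w})"
    using KbiG_val_bounds[OF assms(1,2)] assms(1) by (intro bdd_belowI[of _ 0]) fastforce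
  then have "(INF u\<in>R `` {w}. KbiG_val R v \<phi> u) \<le> KbiG_val R v \<phi> u"
    using assms(3) by (intro cINF_lower) auto
  then show ?thesis using assms(3) by auto
qed

lemma KbiG_val_Dia_ge:
  assumes "R \<subseteq> W \<times> W" and "KbiG_valuation W v" and "(w, u) \<in> R"
  shows "KbiG_val R v \<phi> u \<le> KbiG_val R v (Dia \<phi>) w"
proof -
  have "bdd_above (KbiG_val R v \<phi> ` R `` {w})"
    using KbiG_val_bounds[OF assms(1,2)] assms(1) by (intro bdd_aboveI[of _ 1]) fastforce
  then have "KbiG_val R v \<phi> u \<le> (SUP u\<in>R `` {w}. KbiG_val R v \<phi> u)"
    using assms(3) by (intro cSUP_upper) auto
  then show ?thesis using assms(3) by auto
qed

text \<open>Strictness carries the \<open>Dia\<close> case: a supremum above \<open>c\<close> is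
  exceeded somewhere, even if it is not attained, and that successor is the classical
  witness.\<close>

lemma sahlqvist_antecedent_cut:
  assumes "sahlqvist_antecedent \<phi>"
    and "R \<subseteq> W \<times> W" and "KbiG_valuation W v" and "0 \<le> c"
    and "c < KbiG_val R v \<phi> w"
  shows "K_true R (\<lambda>p u. c < v p u) \<phi> w"
  using assms(1,5)
proof (induction arbitrary: w)
  case (2 p)
  \<comment> \<open>A value above \<open>c \<ge> 0\<close> forces \<open>v p w = 0\<close>, which
    does not exceed \<open>c\<close>.\<close>
  then show ?case using assms(4) by (auto split: if_splits)
next
  case (3 k p)
  then show ?case
  proof (induction k arbitrary: w)
    case (Suc k)
    have "c < KbiG_val R v ((Box ^^ k) (Var p)) u" if "(w, u) \<in> R" for u
      using Suc.prems KbiG_val_Box_le[OF assms(2,3) that, of "(Box ^^ k) (Var p)"] by simp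
    then show ?case using Suc.IH by simp
  qed simp
next
  case (6 \<phi>)
  \<comment> \<open>At a world without successors \<open>Dia\<close> takes the value 0, which is not
    above \<open>c\<close>.\<close>
  then have ne: "R `` {w} \<noteq> {}" and "c < (SUP u\<in>R `` {w}. KbiG_val R v \<phi> u)"
    using assms(4) by (auto split: if_splits)
  then obtain u where "u \<in> R `` {w}" "c < KbiG_val R v \<phi> u"
    by (meson cSUP_least not_le)
  then show ?case using "6.IH" by auto
qed (auto simp: less_max_iff_disj)

text \<open>Only a weak bound survives, since an infimum of values above \<open>c\<close> may equal
  \<open>c\<close>. The bound \<open>c \<le> 1\<close> covers \<open>Box\<close> at a world without
  successors, where the value is 1.\<close>

lemma positive_cut:
  assumes "positive \<chi>"
    and "R \<subseteq> W \<times> W" and "KbiG_valuation W v" and "c \<le> 1"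
    and "K_true R (\<lambda>p u. c < v p u) \<chi> w"
  shows "c \<le> KbiG_val R v \<chi> w"
  using assms(1,5)
proof (induction arbitrary: w)
  case (4 \<chi>)
  then show ?case using assms(4) by (auto intro!: cINF_greatest)
next
  case (5 \<chi>)
  then obtain u where u: "(w, u) \<in> R" "c \<le> KbiG_val R v \<chi> u"
    by auto
  then show ?case using KbiG_val_Dia_ge[OF assms(2,3) u(1)] order_trans by blast
qed (auto simp: le_max_iff_disj)

lemma sahlqvist_implication_K_valid_imp_KbiG_valid:
  assumes "sahlqvist_implication \<tau>" and R: "R \<subseteq> W \<times> W" and w: "w \<in> W"
    and valid: "K_valid_at R w \<tau>"
  shows "KbiG_valid_at W R w \<tau>"
proof -
  obtain \<phi> \<chi> where \<tau>: "\<tau> = Imp \<phi> \<chi>"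
    and \<phi>: "sahlqvist_antecedent \<phi>" and \<chi>: "positive \<chi>"
    using assms(1) unfolding sahlqvist_implication_def by blast
  have "KbiG_val R v \<phi> w \<le> KbiG_val R v \<chi> w" if v: "KbiG_valuation W v" for v
  proof (rule ccontr)
    assume "\<not> ?thesis"
    then have "KbiG_val R v \<chi> w < KbiG_val R v \<phi> w" by simp
    \<comment> \<open>A level strictly between the two values is needed: strictly below for the
      antecedent cut, strictly above to contradict the weak bound on \<open>\<chi>\<close>.\<close>
    then obtain c where c: "KbiG_val R v \<chi> w < c" "c < KbiG_val R v \<phi> w"
      using dense by meson
    have "0 \<le> KbiG_val R v \<chi> w" "KbiG_val R v \<phi> w \<le> 1"
      using KbiG_val_bounds[OF R v w] by auto
    with c have c01: "0 \<le> c" "c \<le> 1" by auto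
    have "K_true R (\<lambda>p u. c < v p u) \<phi> w"
      using sahlqvist_antecedent_cut[OF \<phi> R v c01(1) c(2)] .
    then have "K_true R (\<lambda>p u. c < v p u) \<chi> w"
      using valid by (simp add: K_valid_at_def \<tau>)
    then show False
      using positive_cut[OF \<chi> R v c01(2)] c(1) by fastforce
  qed
  then show ?thesis by (simp add: KbiG_valid_at_def \<tau>)
qed

text \<open>The world varies in the induction because \<open>Box\<close> passes to
  successors.\<close>

lemma K_valid_imp_KbiG_valid:
  assumes "sahlqvist \<phi>" and R: "R \<subseteq> W \<times> W" and "w \<in> W" and "K_valid_at R w \<phi>"
  shows "KbiG_valid_at W R w \<phi>"
  using assms(1,3,4)
proof (induction arbitrary: w)
  case (1 \<tau>)
  then show ?case using R by (intro sahlqvist_implication_K_valid_imp_KbiG_valid)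
next
  case (2 \<phi> \<psi>)
  then show ?case by (simp add: K_valid_at_def KbiG_valid_at_def)
next
  case (3 \<phi> \<psi>)
  have "K_valid_at R w \<phi> \<or> K_valid_at R w \<psi>"
    using K_valid_Or_disjoint[OF "3.prems"(2) "3.hyps"(3)] .
  then have "KbiG_valid_at W R w \<phi> \<or> KbiG_valid_at W R w \<psi>"
    using "3.IH" \<open>w \<in> W\<close> by auto
  moreover have "KbiG_val R v \<theta> w \<le> 1" if "KbiG_valuation W v" for v \<theta>
    using KbiG_val_bounds[OF R that \<open>w \<in> W\<close>] by auto
  \<comment> \<open>One disjunct always has value 1 and the other at most 1, so the maximum is
    1.\<close>
  ultimately show ?case by (auto simp: KbiG_valid_at_def intro!: max_absorb1 max_absorb2)
next
  case (4 \<phi>)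
  \<comment> \<open>The quantifiers over valuations and successors commute, so validity of
    \<open>Box \<phi>\<close> at \<open>w\<close> is validity of \<open>\<phi>\<close> at every
    successor.\<close>
  then have "KbiG_valid_at W R u \<phi>" if "u \<in> R `` {w}" for u
    using that R by (auto simp: K_valid_at_def)
  then show ?case by (simp add: KbiG_valid_at_def)
qed

theorem theorem6:
  fixes \<phi> :: "'p fm"
  assumes "sahlqvist \<phi>"
  shows "locally_transferrable TYPE('w) \<phi>"
  unfolding locally_transferrable_def
proof (intro allI impI ballI iffI)
  fix W :: "'w set" and R w
  assume "crisp_frame W R" and "w \<in> W" and "K_valid_at R w \<phi>"
  with assms show "KbiG_valid_at W R w \<phi>"
    by (intro K_valid_imp_KbiG_valid) (auto simp: crisp_frame_def)
qed (rule KbiG_valid_imp_K_valid)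

end
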